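(* Let $0<p<1$ and let $(\Omega,\mathbf{\Sigma},\mu)$ be a complete probability space. Let $X$ be a closed subspace of $L^p(\mu)=L^p(\Omega,\mathbf{\Sigma},\mu)$ containing the constants, and let $P:X\to X$ be a contractive projection satisfying $P\mathbf{1}=\mathbf{1}$, where $\mathbf 1$ is the constant function $1$. Put $$\mathcal{E}:=\{f\in X:\ f\in L^\infty(\mu),\ Pf\in L^\infty(\mu)\}.$$ Then there exists a complete sub $\sigma$-algebra $\mathbf{\Sigma}'$ of $\mathbf{\Sigma}$ such that $$Pf=\mathbb{E}(f\mid\mathbf{\Sigma}')\quad\text{for all } f\in\mathcal{E}.$$
   Context: Functions are complex-valued. For $0<p<1$, $L^p(\mu)$ carries the quasi-norm $\|f\|_p=(\int_\Omega|f|^p\,d\mu)^{1/p}$. A contractive projection on a (quasi-)normed space $X$ is a nonzero bounded linear operator $P:X\to X$ with $P^2=P$ and $\|P\|:=\sup_{\|x\|=1}\|Px\|=1$. A sub $\sigma$-algebra of $\mathbf\Sigma$ is complete if it contains all $\mu$-null sets. For a complete sub $\sigma$-algebra $\mathbf{\Sigma}'$, $\mathbb{E}(\cdot\mid\mathbf{\Sigma}'):L^1(\Omega,\mathbf\Sigma,\mu)\to L^1(\Omega,\mathbf\Sigma',\mu)$ is the conditional expectation, determined by $\int_F\mathbb{E}(f\mid\mathbf{\Sigma}')\,d\mu=\int_F f\,d\mu$ for all $F\in\mathbf{\Sigma}'$. *)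

theory Defs
  imports "HOL-Probability.Probability"
begin

text \<open>
  An element of \<open>L\<^sup>p(\<mu>)\<close> is represented by a measurable function; two functions represent the same
  element iff they agree almost everywhere.  Accordingly, a set of elements of \<open>L\<^sup>p(\<mu>)\<close> is a set of
  functions closed under almost everywhere equality, and an operator is a map on functions that
  respects it, all equations between values of the operator being read almost everywhere.
\<close>

definition ae_eq :: "'a measure \<Rightarrow> ('a \<Rightarrow> complex) \<Rightarrow> ('a \<Rightarrow> complex) \<Rightarrow> bool" where
  "ae_eq M f g \<longleftrightarrow> (AE x in M. f x = g x)"

definition Lp :: "real \<Rightarrow> 'a measure \<Rightarrow> ('a \<Rightarrow> complex) set" where
  "Lp p M = {f \<in> borel_measurable M. integrable M (\<lambda>x. norm (f x) powr p)}"

definition Lp_norm :: "real \<Rightarrow> 'a measure \<Rightarrow> ('a \<Rightarrow> complex) \<Rightarrow> real" where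
  "Lp_norm p M f = (\<integral>x. norm (f x) powr p \<partial>M) powr (1 / p)"

definition Linf :: "'a measure \<Rightarrow> ('a \<Rightarrow> complex) set" where
  "Linf M = {f \<in> borel_measurable M. \<exists>C::real. AE x in M. norm (f x) \<le> C}"

text \<open>
  Closedness is sequential; the topology of \<open>L\<^sup>p(\<mu>)\<close> is metrizable, for \<open>p < 1\<close> by the metric
  \<open>\<parallel>f - g\<parallel>\<^sub>p\<close> raised to the power \<open>p\<close>.
\<close>

definition closed_subspace_Lp :: "real \<Rightarrow> 'a measure \<Rightarrow> ('a \<Rightarrow> complex) set \<Rightarrow> bool" where
  "closed_subspace_Lp p M X \<longleftrightarrow>
     X \<subseteq> Lp p M \<and>
     (\<forall>f\<in>X. \<forall>g\<in>borel_measurable M. ae_eq M f g \<longrightarrow> g \<in> X) \<and>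
     (\<lambda>x. 0) \<in> X \<and>
     (\<forall>f\<in>X. \<forall>g\<in>X. (\<lambda>x. f x + g x) \<in> X) \<and>
     (\<forall>c. \<forall>f\<in>X. (\<lambda>x. c * f x) \<in> X) \<and>
     (\<forall>u f. (\<forall>n::nat. u n \<in> X) \<longrightarrow> f \<in> Lp p M \<longrightarrow>
        (\<lambda>n. Lp_norm p M (\<lambda>x. u n x - f x)) \<longlonglongrightarrow> 0 \<longrightarrow> f \<in> X)"

definition bounded_linear_operator_on ::
  "real \<Rightarrow> 'a measure \<Rightarrow> ('a \<Rightarrow> complex) set \<Rightarrow> (('a \<Rightarrow> complex) \<Rightarrow> 'a \<Rightarrow> complex) \<Rightarrow> bool" where
  "bounded_linear_operator_on p M X P \<longleftrightarrow>
     (\<forall>f\<in>X. P f \<in> X) \<and>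
     (\<forall>f\<in>X. \<forall>g\<in>X. ae_eq M f g \<longrightarrow> ae_eq M (P f) (P g)) \<and>
     (\<forall>f\<in>X. \<forall>g\<in>X. ae_eq M (P (\<lambda>x. f x + g x)) (\<lambda>x. P f x + P g x)) \<and>
     (\<forall>c. \<forall>f\<in>X. ae_eq M (P (\<lambda>x. c * f x)) (\<lambda>x. c * P f x)) \<and>
     (\<exists>C. \<forall>f\<in>X. Lp_norm p M (P f) \<le> C * Lp_norm p M f)"

definition operator_norm ::
  "real \<Rightarrow> 'a measure \<Rightarrow> ('a \<Rightarrow> complex) set \<Rightarrow> (('a \<Rightarrow> complex) \<Rightarrow> 'a \<Rightarrow> complex) \<Rightarrow> real" where
  "operator_norm p M X P = (SUP f\<in>{f\<in>X. Lp_norm p M f = 1}. Lp_norm p M (P f))"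

definition contractive_projection ::
  "real \<Rightarrow> 'a measure \<Rightarrow> ('a \<Rightarrow> complex) set \<Rightarrow> (('a \<Rightarrow> complex) \<Rightarrow> 'a \<Rightarrow> complex) \<Rightarrow> bool" where
  "contractive_projection p M X P \<longleftrightarrow>
     bounded_linear_operator_on p M X P \<and>
     (\<exists>f\<in>X. \<not> ae_eq M (P f) (\<lambda>x. 0)) \<and>
     (\<forall>f\<in>X. ae_eq M (P (P f)) (P f)) \<and>
     operator_norm p M X P = 1"

definition complete_subalgebra :: "'a measure \<Rightarrow> 'a measure \<Rightarrow> bool" where
  "complete_subalgebra M F \<longleftrightarrow> subalgebra M F \<and> null_sets M \<subseteq> sets F"

text \<open>
  The library's conditional expectation is real-valued.  It depends on \<open>F\<close> only through its
  \<open>\<sigma>\<close>-algebra; the measure carried by \<open>F\<close> plays no role.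
\<close>

definition complex_cond_exp :: "'a measure \<Rightarrow> 'a measure \<Rightarrow> ('a \<Rightarrow> complex) \<Rightarrow> 'a \<Rightarrow> complex" where
  "complex_cond_exp M F f =
     (\<lambda>x. Complex (real_cond_exp M F (\<lambda>y. Re (f y)) x) (real_cond_exp M F (\<lambda>y. Im (f y)) x))"

lemma Re_set_lebesgue_integral:
  fixes f :: "'a \<Rightarrow> complex"
  assumes "integrable M f" "A \<in> sets M"
  shows "Re (\<integral>x\<in>A. f x \<partial>M) = (\<integral>x\<in>A. Re (f x) \<partial>M)"
    and "Im (\<integral>x\<in>A. f x \<partial>M) = (\<integral>x\<in>A. Im (f x) \<partial>M)"
proof -
  have i: "integrable M (\<lambda>x. indicator A x *\<^sub>R f x)"
    using assms by (intro integrable_mult_indicator)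
  show "Re (\<integral>x\<in>A. f x \<partial>M) = (\<integral>x\<in>A. Re (f x) \<partial>M)"
    using integral_Re[OF i] by (simp add: set_lebesgue_integral_def)
  show "Im (\<integral>x\<in>A. f x \<partial>M) = (\<integral>x\<in>A. Im (f x) \<partial>M)"
    using integral_Im[OF i] by (simp add: set_lebesgue_integral_def)
qed

lemma complex_cond_exp_measurable:
  "complex_cond_exp M F f \<in> borel_measurable F"
proof -
  have "complex_cond_exp M F f = (\<lambda>x. of_real (real_cond_exp M F (\<lambda>y. Re (f y)) x)
          + \<i> * of_real (real_cond_exp M F (\<lambda>y. Im (f y)) x))"
    by (simp add: complex_cond_exp_def fun_eq_iff complex_eq_iff)
  then show ?thesis by simp
qed

lemma (in sigma_finite_subalgebra) complex_cond_exp_integrable: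
  assumes "integrable M f"
  shows "integrable M (complex_cond_exp M F f)"
proof -
  have "complex_cond_exp M F f = (\<lambda>x. of_real (real_cond_exp M F (\<lambda>y. Re (f y)) x)
          + \<i> * of_real (real_cond_exp M F (\<lambda>y. Im (f y)) x))"
    by (simp add: complex_cond_exp_def fun_eq_iff complex_eq_iff)
  moreover have "integrable M (real_cond_exp M F (\<lambda>y. Re (f y)))"
    "integrable M (real_cond_exp M F (\<lambda>y. Im (f y)))"
    using assms by (auto intro!: real_cond_exp_int(1))
  ultimately show ?thesis by simp
qed

lemma (in sigma_finite_subalgebra) complex_cond_exp_set_integral:
  assumes "integrable M f" "A \<in> sets F"
  shows "(\<integral>x\<in>A. complex_cond_exp M F f x \<partial>M) = (\<integral>x\<in>A. f x \<partial>M)"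
proof -
  have A: "A \<in> sets M" using assms(2) subalg unfolding subalgebra_def by blast
  have *: "(\<integral>x\<in>A. Re (f x) \<partial>M) = (\<integral>x\<in>A. real_cond_exp M F (\<lambda>y. Re (f y)) x \<partial>M)"
    "(\<integral>x\<in>A. Im (f x) \<partial>M) = (\<integral>x\<in>A. real_cond_exp M F (\<lambda>y. Im (f y)) x \<partial>M)"
    using assms by (auto intro!: real_cond_exp_intA)
  show ?thesis
    using * Re_set_lebesgue_integral[OF assms(1) A]
      Re_set_lebesgue_integral[OF complex_cond_exp_integrable[OF assms(1)] A]
    by (intro complex_eqI) (simp_all add: complex_cond_exp_def)
qed

lemma (in sigma_finite_subalgebra) complex_cond_exp_unique:
  assumes "integrable M f" "integrable M g" "g \<in> borel_measurable F"
    and eq: "\<And>A. A \<in> sets F \<Longrightarrow> (\<integral>x\<in>A. g x \<partial>M) = (\<integral>x\<in>A. f x \<partial>M)"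
  shows "AE x in M. complex_cond_exp M F f x = g x"
proof -
  have sub: "A \<in> sets M" if "A \<in> sets F" for A
    using that subalg unfolding subalgebra_def by blast
  have "AE x in M. real_cond_exp M F (\<lambda>y. Re (f y)) x = Re (g x)"
  proof (rule real_cond_exp_charact)
    show "(\<integral>x\<in>A. Re (f x) \<partial>M) = (\<integral>x\<in>A. Re (g x) \<partial>M)" if "A \<in> sets F" for A
      using eq[OF that] Re_set_lebesgue_integral(1)[OF _ sub[OF that]] assms(1,2) by metis
  qed (use assms in auto)
  moreover have "AE x in M. real_cond_exp M F (\<lambda>y. Im (f y)) x = Im (g x)"
  proof (rule real_cond_exp_charact)
    show "(\<integral>x\<in>A. Im (f x) \<partial>M) = (\<integral>x\<in>A. Im (g x) \<partial>M)" if "A \<in> sets F" for A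
      using eq[OF that] Re_set_lebesgue_integral(2)[OF _ sub[OF that]] assms(1,2) by metis
  qed (use assms in auto)
  ultimately show ?thesis
    by eventually_elim (simp add: complex_cond_exp_def complex_eq_iff)
qed

end

theory Submission
  imports Defs "HOL-Complex_Analysis.Cauchy_Integral_Theorem"
begin

text \<open>
  Let \<open>Y\<close> be the space of bounded fixed points of \<open>P\<close> and \<open>h = f - P f\<close> with \<open>f \<in> \<E>\<close>. For small
  \<open>g \<in> Y\<close> put \<open>G = 1 + g\<close>. Contractivity gives \<open>\<parallel>G + t P f\<parallel>\<^sub>p \<le> \<parallel>G + t f\<parallel>\<^sub>p\<close> for complex \<open>t\<close>, with
  equality at \<open>t = 0\<close>, so comparing first-order terms yields \<open>\<integral> G\<^bsup>p/2-1\<^esup> cnj(G)\<^bsup>p/2\<^esup> h = 0\<close>.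
  Differentiating this identity repeatedly in directions from \<open>Y\<close> never kills the coefficients,
  because the exponents stay non-integral; at \<open>g = 0\<close> it shows that \<open>h\<close> is orthogonal to all monomials
  in elements of \<open>Y\<close> and their conjugates. By Weierstrass approximation \<open>h\<close> has integral zero over every
  set of the sigma-algebra generated by \<open>Y\<close> and the null sets, and \<open>P f \<in> Y\<close> is measurable for it.
\<close>

subsection \<open>Essentially bounded functions\<close>

lemma Linf_measurable: "f \<in> Linf M \<Longrightarrow> f \<in> borel_measurable M"
  by (simp add: Linf_def)

lemma LinfE:
  assumes "f \<in> Linf M"
  obtains C where "C \<ge> 0" "AE x in M. norm (f x) \<le> C"
proof -
  obtain C where C: "AE x in M. norm (f x) \<le> C"
    using assms by (auto simp: Linf_def)
  show ?thesis
    by (rule that[of "\<bar>C\<bar>"]) (use C in \<open>auto elim!: eventually_mono\<close>)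
qed

lemma LinfI: "f \<in> borel_measurable M \<Longrightarrow> AE x in M. norm (f x) \<le> C \<Longrightarrow> f \<in> Linf M"
  by (auto simp: Linf_def)

lemma Linf_const [simp]: "(\<lambda>x. c) \<in> Linf M"
  by (rule LinfI[of _ _ "norm c"]) auto

lemma Linf_add:
  assumes "f \<in> Linf M" "g \<in> Linf M"
  shows "(\<lambda>x. f x + g x) \<in> Linf M"
proof -
  from assms obtain C D where "AE x in M. norm (f x) \<le> C" "AE x in M. norm (g x) \<le> D"
    by (metis LinfE)
  then have "AE x in M. norm (f x + g x) \<le> C + D"
    by eventually_elim (rule norm_triangle_mono)
  then show ?thesis
    using assms[THEN Linf_measurable] by (intro LinfI) auto
qed

lemma Linf_mult:
  assumes "f \<in> Linf M" "g \<in> Linf M"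
  shows "(\<lambda>x. f x * g x) \<in> Linf M"
proof -
  from assms obtain C D where "C \<ge> 0" "AE x in M. norm (f x) \<le> C" "AE x in M. norm (g x) \<le> D"
    by (metis LinfE)
  then have "AE x in M. norm (f x * g x) \<le> C * D"
    by (auto simp: norm_mult elim!: eventually_elim2 intro!: mult_mono)
  then show ?thesis
    using assms[THEN Linf_measurable] by (intro LinfI) auto
qed

lemma Linf_cnj: "f \<in> Linf M \<Longrightarrow> (\<lambda>x. cnj (f x)) \<in> Linf M"
  using borel_measurable_complex_iff[of "\<lambda>x. cnj (f x)" M] borel_measurable_complex_iff[of f M]
  by (auto simp: Linf_def)

lemma Linf_diff: "f \<in> Linf M \<Longrightarrow> g \<in> Linf M \<Longrightarrow> (\<lambda>x. f x - g x) \<in> Linf M"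
  using Linf_add[of f M "\<lambda>x. - 1 * g x"] Linf_mult[of "\<lambda>x. - 1" M g] by simp

lemma Linf_indicator: "A \<in> sets M \<Longrightarrow> indicator A \<in> Linf M"
  by (rule LinfI[of _ _ 1]) (auto simp: indicator_def)

lemma (in finite_measure) Linf_integrable: "f \<in> Linf M \<Longrightarrow> integrable M f"
  by (auto simp: Linf_def intro: integrable_const_bound)

text \<open>Dominated convergence with a constant as majorant, which is integrable because the
  measure is finite.\<close>

lemma (in finite_measure) integral_bounded_convergence:
  fixes f :: "nat \<Rightarrow> 'a \<Rightarrow> complex"
  assumes "g \<in> borel_measurable M" "\<And>n. f n \<in> borel_measurable M"
    and "AE x in M. (\<lambda>n. f n x) \<longlonglongrightarrow> g x"
    and "\<And>n. AE x in M. norm (f n x) \<le> C"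
  shows "(\<lambda>n. \<integral>x. f n x \<partial>M) \<longlonglongrightarrow> (\<integral>x. g x \<partial>M)"
  by (rule integral_dominated_convergence[where w = "\<lambda>_. C"]) (use assms in auto)

subsection \<open>Mixed powers and their directional derivatives\<close>

text \<open>On the right half-plane this is w^a times conj(w)^b on the principal branch. Conjugating
  after taking the power, rather than before, makes the case of equal exponents depend on
  \<open>norm w\<close> alone even on the negative axis.\<close>

definition mixed_power :: "real \<Rightarrow> real \<Rightarrow> complex \<Rightarrow> complex" where
  "mixed_power a b w = w powr of_real a * cnj (w powr of_real b)"

text \<open>Off the branch cut this is the real-linear differential at \<open>w\<close> in the
  direction \<open>v\<close>; the summands are its complex-linear and conjugate-linear
  parts.\<close>

definition mixed_power_deriv :: "real \<Rightarrow> real \<Rightarrow> complex \<Rightarrow> complex \<Rightarrow> complex" where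
  "mixed_power_deriv a b w v =
     of_real a * mixed_power (a - 1) b w * v + of_real b * mixed_power a (b - 1) w * cnj v"

lemma mixed_power_1 [simp]: "mixed_power a b 1 = 1"
  by (simp add: mixed_power_def powr_def)

lemma cnj_mixed_power: "cnj (mixed_power a b w) = mixed_power b a w"
  by (simp add: mixed_power_def mult.commute)

text \<open>For \<open>a = p/2\<close> this is |w|^p, the integrand of the p-th power of the
  quasi-norm, so contractivity can be differentiated within the calculus of mixed powers.\<close>

lemma mixed_power_diagonal: "mixed_power a a w = of_real (norm w powr (2 * a))"
proof -
  have "mixed_power a a w = of_real ((norm (w powr of_real a))\<^sup>2)"
    unfolding mixed_power_def by (rule complex_norm_square[symmetric])
  also have "norm (w powr of_real a) = norm w powr a"
    by (simp add: norm_powr_real_powr')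
  finally show ?thesis
    by (simp add: power2_eq_square flip: powr_add)
qed

lemma measurable_mixed_power [measurable]:
  assumes "W \<in> borel_measurable M"
  shows "(\<lambda>x. mixed_power a b (W x)) \<in> borel_measurable M"
proof -
  have [measurable]: "(\<lambda>w::complex. w powr c) \<in> borel_measurable borel" for c
    unfolding powr_def by measurable
  have "(\<lambda>w. mixed_power a b w) \<in> borel_measurable borel"
    unfolding mixed_power_def
    by (intro borel_measurable_times borel_measurable_continuous_on[of cnj]) (auto intro: continuous_intros)
  then show ?thesis
    using assms by measurable
qed

lemma measurable_mixed_power_deriv [measurable]:
  assumes [measurable]: "W \<in> borel_measurable M" "g \<in> borel_measurable M"
  shows "(\<lambda>x. mixed_power_deriv a b (W x) (g x)) \<in> borel_measurable M"
proof -
  have [measurable]: "(\<lambda>x. cnj (g x)) \<in> borel_measurable M"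
    by (intro borel_measurable_continuous_on[of cnj]) (auto intro: continuous_intros)
  show ?thesis
    unfolding mixed_power_deriv_def by measurable
qed

lemma cball_1_half_Re_pos:
  assumes "w \<in> cball 1 (1/2 :: real)"
  shows "Re w > 0"
  using assms abs_Re_le_cmod[of "1 - w"] by (auto simp: dist_norm)

text \<open>The closed disc of radius 1/2 about 1 is compact and avoids the branch cut, so mixed
  powers are continuous and bounded there for all real exponents.\<close>

lemma bounded_mixed_power:
  obtains K where "K \<ge> 0" "\<And>w. w \<in> cball 1 (1/2) \<Longrightarrow> norm (mixed_power a b w) \<le> K"
proof -
  have "continuous_on (cball 1 (1/2)) (mixed_power a b)"
    unfolding mixed_power_def
    using cball_1_half_Re_pos by (intro continuous_intros) force+
  then have "bounded (mixed_power a b ` cball 1 (1/2))"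
    by (intro compact_imp_bounded compact_continuous_image) auto
  then obtain K where "K > 0" "\<And>w. w \<in> cball 1 (1/2) \<Longrightarrow> norm (mixed_power a b w) \<le> K"
    by (auto simp: bounded_pos)
  then show ?thesis
    using that[of K] by simp
qed

lemma bounded_mixed_power_deriv:
  obtains K where "K \<ge> 0"
    "\<And>w v. w \<in> cball 1 (1/2) \<Longrightarrow> norm (mixed_power_deriv a b w v) \<le> K * norm v"
proof -
  obtain K where K: "K \<ge> 0" "\<And>w. w \<in> cball 1 (1/2) \<Longrightarrow> norm (mixed_power (a - 1) b w) \<le> K"
    by (rule bounded_mixed_power[of "a - 1" b]) blast
  obtain L where L: "L \<ge> 0" "\<And>w. w \<in> cball 1 (1/2) \<Longrightarrow> norm (mixed_power a (b - 1) w) \<le> L"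
    by (rule bounded_mixed_power[of a "b - 1"]) blast
  show ?thesis
  proof (rule that[of "\<bar>a\<bar> * K + \<bar>b\<bar> * L"])
    fix w :: complex and v :: complex assume "w \<in> cball 1 (1/2)"
    then have "norm (mixed_power_deriv a b w v) \<le> \<bar>a\<bar> * K * norm v + \<bar>b\<bar> * L * norm v"
      unfolding mixed_power_deriv_def
      by (intro norm_triangle_mono) (auto simp: norm_mult intro!: mult_mono mult_nonneg_nonneg K L)
    then show "norm (mixed_power_deriv a b w v) \<le> (\<bar>a\<bar> * K + \<bar>b\<bar> * L) * norm v"
      by (simp add: algebra_simps)
  qed (use K L in auto)
qed

text \<open>The product rule for z^a and the conjugate of z^b along a real line, at a point of the
  right half-plane.\<close>

lemma has_vector_derivative_mixed_power:
  assumes "Re (w + of_real t * v) > 0"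
  shows "((\<lambda>t. mixed_power a b (w + of_real t * v)) has_vector_derivative
           mixed_power_deriv a b (w + of_real t * v) v) (at t within S)"
proof -
  let ?z = "w + of_real t * v"
  have z: "?z \<notin> \<real>\<^sub>\<le>\<^sub>0"
    using assms by (auto simp: complex_nonpos_Reals_iff)
  have line: "((\<lambda>t. w + of_real t * v) has_vector_derivative v) (at t)"
    by (auto intro!: derivative_eq_intros)
  have pow: "((\<lambda>t. (w + of_real t * v) powr of_real c) has_vector_derivative
      v * (of_real c * ?z powr of_real (c - 1))) (at t)" for c
    using field_vector_diff_chain_at[OF line has_field_derivative_powr[OF z, of "of_real c"]]
    by (simp add: o_def)
  have "((\<lambda>t. mixed_power a b (w + of_real t * v)) has_vector_derivative
           mixed_power_deriv a b ?z v) (at t)"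
    unfolding mixed_power_def
    by (rule has_vector_derivative_eq_rhs
        [OF has_vector_derivative_mult[OF pow has_vector_derivative_cnj[OF pow]]])
      (simp add: mixed_power_deriv_def mixed_power_def algebra_simps)
  then show ?thesis
    by (rule has_vector_derivative_at_within)
qed

text \<open>The mean value inequality on the segment between the two points, which lies in the disc
  by convexity. After division by \<open>t\<close> the bound no longer depends on \<open>t\<close>,
  so it can dominate difference quotients.\<close>

lemma mixed_power_increment_bound:
  assumes K: "\<And>w v. w \<in> cball 1 (1/2) \<Longrightarrow> norm (mixed_power_deriv a b w v) \<le> K * norm v"
    and "w \<in> cball 1 (1/2)" "w + of_real t * v \<in> cball 1 (1/2)" "t > 0"
  shows "norm (mixed_power a b (w + of_real t * v) - mixed_power a b w) \<le> K * norm v * t"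
proof -
  let ?f = "\<lambda>t. mixed_power a b (w + of_real t * v)"
  have in_ball: "w + of_real s * v \<in> cball 1 (1/2)" if "s \<in> {0..t}" for s
  proof -
    have "(1 - s/t) *\<^sub>R w + (s/t) *\<^sub>R (w + of_real t * v) \<in> cball 1 (1/2)"
      using that assms by (intro convexD) auto
    also have "(1 - s/t) *\<^sub>R w + (s/t) *\<^sub>R (w + of_real t * v) = w + of_real s * v"
      using \<open>t > 0\<close> by (simp add: algebra_simps scaleR_conv_of_real)
    finally show ?thesis .
  qed
  have "norm (?f t - ?f 0) \<le> K * norm v * norm (t - 0)"
  proof (rule differentiable_bound[where S = "{0..t}"])
    fix s assume s: "s \<in> {0..t}"
    show "(?f has_derivative (\<lambda>h. h *\<^sub>R mixed_power_deriv a b (w + of_real s * v) v)) (at s within {0..t})"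
      using has_vector_derivative_mixed_power[OF cball_1_half_Re_pos[OF in_ball[OF s]]]
      unfolding has_vector_derivative_def .
    show "onorm (\<lambda>h. h *\<^sub>R mixed_power_deriv a b (w + of_real s * v) v) \<le> K * norm v"
      using K[OF in_ball[OF s], of v]
      by (intro onorm_le) (metis mult.commute mult_right_mono norm_ge_zero norm_scaleR real_norm_def)
  qed (use \<open>t > 0\<close> in auto)
  then show ?thesis
    using \<open>t > 0\<close> by simp
qed

text \<open>The derivative at 0 is restated along a null sequence, the form in which dominated
  convergence uses it.\<close>

lemma mixed_power_difference_quotient:
  assumes "Re w > 0" "t \<longlonglongrightarrow> 0" "\<And>n. t n \<noteq> 0"
  shows "(\<lambda>n. (mixed_power a b (w + of_real (t n) * v) - mixed_power a b w) / of_real (t n))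
           \<longlonglongrightarrow> mixed_power_deriv a b w v"
proof -
  let ?f = "\<lambda>t. mixed_power a b (w + of_real t * v)" and ?D = "mixed_power_deriv a b w v"
  have "(?f has_vector_derivative ?D) (at 0)"
    using has_vector_derivative_mixed_power[of w 0 v a b UNIV] assms(1) by simp
  then have "(\<lambda>h. norm (?f (0 + h) - ?f 0 - h *\<^sub>R ?D) / norm h) \<midarrow>0\<rightarrow> 0"
    unfolding has_vector_derivative_def has_derivative_at by blast
  then have "(\<lambda>n. norm (?f (t n) - ?f 0 - t n *\<^sub>R ?D) / norm (t n)) \<longlonglongrightarrow> 0"
    unfolding tendsto_at_iff_sequentially using assms(2,3) by (auto simp: o_def)
  moreover have "norm (?f (t n) - ?f 0 - t n *\<^sub>R ?D) / norm (t n) =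
      norm ((?f (t n) - ?f 0) / of_real (t n) - ?D)" for n
  proof -
    have "(?f (t n) - ?f 0) / of_real (t n) - ?D = (?f (t n) - ?f 0 - t n *\<^sub>R ?D) / of_real (t n)"
      using assms(3)[of n] by (simp add: scaleR_conv_of_real diff_divide_distrib)
    then show ?thesis
      by (simp only: norm_divide norm_of_real real_norm_def)
  qed
  ultimately have "(\<lambda>n. norm ((?f (t n) - ?f 0) / of_real (t n) - ?D)) \<longlonglongrightarrow> 0"
    by simp
  then show ?thesis
    by (simp add: tendsto_norm_zero_iff LIM_zero_iff)
qed

section \<open>Small perturbations and differentiation under the integral\<close>

text \<open>
  The bound \<open>r\<close> is strict so that a perturbation of \<open>1 + g\<close> by a small multiple of a bounded
  function stays in the disc where the mixed powers are smooth.
\<close>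

definition small :: "'a measure \<Rightarrow> ('a \<Rightarrow> complex) \<Rightarrow> bool" where
  "small M g \<longleftrightarrow> (\<exists>r<1/2. AE x in M. norm (g x) \<le> r)"

text \<open>One sequence of steps serves two directions, because the first-order comparison of
  \<open>f\<close> with \<open>P f\<close> needs difference quotients at the same steps.\<close>

lemma small_perturbation_steps:
  assumes "small M g" "v \<in> Linf M" "w \<in> Linf M"
  obtains t :: "nat \<Rightarrow> real" where "\<And>n. t n > 0" "t \<longlonglongrightarrow> 0"
    "\<And>n. small M (\<lambda>x. g x + of_real (t n) * v x)" "\<And>n. small M (\<lambda>x. g x + of_real (t n) * w x)"
proof -
  obtain r where r: "r < 1/2" "AE x in M. norm (g x) \<le> r"
    using assms(1) by (auto simp: small_def)
  obtain B where B: "B \<ge> 0" "AE x in M. norm (v x) \<le> B"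
    using assms(2) by (rule LinfE)
  obtain C where C: "C \<ge> 0" "AE x in M. norm (w x) \<le> C"
    using assms(3) by (rule LinfE)
  \<comment> \<open>Steps up to \<open>s\<close> use at most half of the gap between
    \<open>r\<close> and 1/2. The summand 1 keeps the denominator positive when both bounds are
    0.\<close>
  define s where "s = (1/2 - r) / (2 * (B + C + 1))"
  have s: "s > 0" and sBC: "s * (B + C + 1) = (1/2 - r) / 2"
    using r B C by (simp_all add: s_def field_simps add_nonneg_eq_0_iff)
  define t where "t n = s / real (Suc n)" for n
  have t: "0 < t n" "t n \<le> s" for n
    using s by (simp_all add: t_def field_simps)
  have small: "small M (\<lambda>x. g x + of_real (t n) * u x)"
    if u: "AE x in M. norm (u x) \<le> D" "D \<le> B + C + 1" for n u and D :: real
  proof -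
    have "AE x in M. norm (g x + of_real (t n) * u x) \<le> r + (1/2 - r) / 2"
      using r(2) u(1)
    proof eventually_elim
      case (elim x)
      have "t n * norm (u x) \<le> s * (B + C + 1)"
        using t[of n] elim u s by (intro mult_mono) auto
      then show ?case
        using elim sBC t(1)[of n] by (intro norm_triangle_mono) (auto simp: norm_mult)
    qed
    moreover have "r + (1/2 - r) / 2 < 1/2"
      using r by (simp add: field_simps)
    ultimately show ?thesis
      unfolding small_def by blast
  qed
  have "t \<longlonglongrightarrow> 0"
    unfolding t_def using LIMSEQ_Suc[OF lim_const_over_n[of s]] by simp
  with t(1) show ?thesis
    using B C by (intro that[of t] small) auto
qed

lemma small_cball: "small M g \<Longrightarrow> AE x in M. 1 + g x \<in> cball 1 (1/2)"
  unfolding small_def by (auto simp: dist_norm elim!: eventually_mono)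

lemma Linf_mixed_power:
  assumes "small M g" "g \<in> borel_measurable M"
  shows "(\<lambda>x. mixed_power a b (1 + g x)) \<in> Linf M"
proof -
  obtain K where "\<And>w. w \<in> cball 1 (1/2) \<Longrightarrow> norm (mixed_power a b w) \<le> K"
    using bounded_mixed_power by blast
  then show ?thesis
    using assms(2) small_cball[OF assms(1)]
    by (intro LinfI[of _ _ K]) (auto elim!: eventually_mono)
qed

text \<open>Differentiation under the integral sign: the quotients converge pointwise where
  \<open>1 + g x\<close> lies in the disc, and the Lipschitz bound times the bound of
  \<open>k\<close> dominates them.\<close>

lemma (in finite_measure) integral_mixed_power_difference_quotient:
  assumes small: "small M g" and g: "g \<in> borel_measurable M"
    and v: "v \<in> Linf M" and k: "k \<in> Linf M"
    and t: "\<And>n. t n > 0" "t \<longlonglongrightarrow> 0" and small_t: "\<And>n. small M (\<lambda>x. g x + of_real (t n) * v x)"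
  shows "(\<lambda>n. ((\<integral>x. mixed_power a b (1 + (g x + of_real (t n) * v x)) * k x \<partial>M) -
            (\<integral>x. mixed_power a b (1 + g x) * k x \<partial>M)) / of_real (t n))
          \<longlonglongrightarrow> (\<integral>x. mixed_power_deriv a b (1 + g x) (v x) * k x \<partial>M)"
proof -
  note [measurable] = g Linf_measurable[OF v] Linf_measurable[OF k]
  obtain K where K: "K \<ge> 0"
      "\<And>w v. w \<in> cball 1 (1/2) \<Longrightarrow> norm (mixed_power_deriv a b w v) \<le> K * norm v"
    by (rule bounded_mixed_power_deriv[of a b]) blast
  obtain B where B: "B \<ge> 0" "AE x in M. norm (v x) \<le> B"
    using v by (rule LinfE)
  obtain C where C: "C \<ge> 0" "AE x in M. norm (k x) \<le> C"
    using k by (rule LinfE)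
  define q where "q n x = (mixed_power a b (1 + g x + of_real (t n) * v x) -
    mixed_power a b (1 + g x)) / of_real (t n) * k x" for n x
  have "(\<lambda>n. \<integral>x. q n x \<partial>M) \<longlonglongrightarrow> (\<integral>x. mixed_power_deriv a b (1 + g x) (v x) * k x \<partial>M)"
  proof (rule integral_bounded_convergence[where C = "K * B * C"])
    show "AE x in M. (\<lambda>n. q n x) \<longlonglongrightarrow> mixed_power_deriv a b (1 + g x) (v x) * k x"
      using small_cball[OF small]
    proof eventually_elim
      case (elim x)
      show ?case
        unfolding q_def using cball_1_half_Re_pos[OF elim] t
        by (intro tendsto_mult_right mixed_power_difference_quotient) (auto simp: less_imp_neq[symmetric])
    qed
    show "AE x in M. norm (q n x) \<le> K * B * C" for n
      using small_cball[OF small] small_cball[OF small_t[of n]] B(2) C(2)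
    proof eventually_elim
      case (elim x)
      have "norm (mixed_power a b (1 + g x + of_real (t n) * v x) - mixed_power a b (1 + g x))
          \<le> K * norm (v x) * t n"
        using elim t(1) K by (intro mixed_power_increment_bound) (auto simp: add.assoc)
      also have "\<dots> \<le> K * B * t n"
        using elim K t(1)[of n] by (intro mult_right_mono mult_left_mono) auto
      finally have "norm ((mixed_power a b (1 + g x + of_real (t n) * v x) - mixed_power a b (1 + g x))
          / of_real (t n)) \<le> K * B"
        using t(1)[of n] by (simp add: norm_divide divide_le_eq)
      then show ?case
        unfolding q_def norm_mult using elim K B by (intro mult_mono) auto
    qed
  qed (simp_all add: q_def)
  moreover have "(\<integral>x. q n x \<partial>M) = ((\<integral>x. mixed_power a b (1 + (g x + of_real (t n) * v x)) * k x \<partial>M) -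
            (\<integral>x. mixed_power a b (1 + g x) * k x \<partial>M)) / of_real (t n)" for n
  proof -
    have int: "integrable M (\<lambda>x. mixed_power a b (1 + h x) * k x)"
      if "small M h" "h \<in> borel_measurable M" for h
      using that k by (intro Linf_integrable Linf_mult Linf_mixed_power)
    have "(\<integral>x. q n x \<partial>M) = (\<integral>x. (mixed_power a b (1 + (g x + of_real (t n) * v x)) * k x -
            mixed_power a b (1 + g x) * k x) / of_real (t n) \<partial>M)"
      unfolding q_def
      by (intro Bochner_Integration.integral_cong refl) (simp add: add.assoc left_diff_distrib)
    also have "\<dots> = ((\<integral>x. mixed_power a b (1 + (g x + of_real (t n) * v x)) * k x \<partial>M) -
            (\<integral>x. mixed_power a b (1 + g x) * k x \<partial>M)) / of_real (t n)"
      using int[OF small g] int[OF small_t[of n]] by simp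
    finally show ?thesis .
  qed
  ultimately show ?thesis
    by simp
qed

subsection \<open>From the power identity to monomials\<close>

text \<open>Factors are prefixed one at a time, so that one differentiation accounts for each
  induction step.\<close>

inductive_set monomials :: "('a \<Rightarrow> complex) set \<Rightarrow> ('a \<Rightarrow> complex) set" for Y where
  one: "(\<lambda>x. 1) \<in> monomials Y"
| mult: "g \<in> Y \<Longrightarrow> m \<in> monomials Y \<Longrightarrow> (\<lambda>x. g x * m x) \<in> monomials Y"
| mult_cnj: "g \<in> Y \<Longrightarrow> m \<in> monomials Y \<Longrightarrow> (\<lambda>x. cnj (g x) * m x) \<in> monomials Y"

definition bounded_subspace :: "'a measure \<Rightarrow> ('a \<Rightarrow> complex) set \<Rightarrow> bool" where
  "bounded_subspace M Y \<longleftrightarrow> Y \<subseteq> Linf M \<and> (\<lambda>x. 0) \<in> Y \<and>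
     (\<forall>g\<in>Y. \<forall>h\<in>Y. (\<lambda>x. g x + h x) \<in> Y) \<and> (\<forall>c. \<forall>g\<in>Y. (\<lambda>x. c * g x) \<in> Y)"

lemma bounded_subspaceD:
  assumes "bounded_subspace M Y"
  shows "g \<in> Y \<Longrightarrow> g \<in> Linf M" "(\<lambda>x. 0) \<in> Y"
    "g \<in> Y \<Longrightarrow> h \<in> Y \<Longrightarrow> (\<lambda>x. g x + h x) \<in> Y" "g \<in> Y \<Longrightarrow> (\<lambda>x. c * g x) \<in> Y"
  using assms unfolding bounded_subspace_def by blast+

lemma Linf_monomial:
  assumes "bounded_subspace M Y" "m \<in> monomials Y"
  shows "m \<in> Linf M"
  using assms(2)
  by induction (auto intro: Linf_mult Linf_mult[OF Linf_cnj] bounded_subspaceD(1)[OF assms(1)])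

text \<open>
  Differentiating in the directions \<open>v\<close> and \<open>\<i> * v\<close> separates the holomorphic from the
  antiholomorphic part of the derivative.
\<close>

lemma (in finite_measure) mixed_power_orthogonal_step:
  assumes Y: "bounded_subspace M Y" and k: "k \<in> Linf M" and "a \<noteq> 0" "b \<noteq> 0"
    and orth: "\<And>g. g \<in> Y \<Longrightarrow> small M g \<Longrightarrow> (\<integral>x. mixed_power a b (1 + g x) * k x \<partial>M) = 0"
    and g: "g \<in> Y" "small M g" and v: "v \<in> Y"
  shows "(\<integral>x. mixed_power (a - 1) b (1 + g x) * (v x * k x) \<partial>M) = 0"
    and "(\<integral>x. mixed_power a (b - 1) (1 + g x) * (cnj (v x) * k x) \<partial>M) = 0"
proof -
  have YL: "u \<in> Linf M" if "u \<in> Y" for u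
    using that by (rule bounded_subspaceD(1)[OF Y])
  \<comment> \<open>Since \<open>Y\<close> is a subspace, the integral vanishes at \<open>g\<close>
    and at all small perturbations \<open>g + t u\<close>; all difference quotients are 0, hence so
    is their limit.\<close>
  have deriv0: "(\<integral>x. mixed_power_deriv a b (1 + g x) (u x) * k x \<partial>M) = 0" if u: "u \<in> Y" for u
  proof -
    obtain t where t: "\<And>n. t n > 0" "t \<longlonglongrightarrow> 0" "\<And>n. small M (\<lambda>x. g x + of_real (t n) * u x)"
      using small_perturbation_steps[OF g(2) YL[OF u] YL[OF u]] by metis
    have "(\<lambda>x. g x + of_real (t n) * u x) \<in> Y" for n
      using u g(1) by (intro bounded_subspaceD(3,4)[OF Y])
    then have "(\<integral>x. mixed_power a b (1 + (g x + of_real (t n) * u x)) * k x \<partial>M) = 0" for n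
      using orth t(3) by blast
    moreover note integral_mixed_power_difference_quotient
      [OF g(2) Linf_measurable[OF YL[OF g(1)]] YL[OF u] k t, of a b]
    ultimately show ?thesis
      using orth[OF g] by (simp add: LIMSEQ_const_iff)
  qed
  define I where "I = (\<integral>x. mixed_power (a - 1) b (1 + g x) * (v x * k x) \<partial>M)"
  define J where "J = (\<integral>x. mixed_power a (b - 1) (1 + g x) * (cnj (v x) * k x) \<partial>M)"
  have int: "integrable M (\<lambda>x. mixed_power a' b' (1 + g x) * (v x * k x))"
      "integrable M (\<lambda>x. mixed_power a' b' (1 + g x) * (cnj (v x) * k x))" for a' b'
    using g YL[OF g(1)] YL[OF v] k
    by (auto intro!: Linf_integrable Linf_mult Linf_cnj Linf_mixed_power Linf_measurable)
  have eq: "(\<integral>x. mixed_power_deriv a b (1 + g x) (c * v x) * k x \<partial>M) =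
      c * of_real a * I + cnj c * of_real b * J" for c
  proof -
    have "(\<integral>x. mixed_power_deriv a b (1 + g x) (c * v x) * k x \<partial>M) =
        (\<integral>x. (c * of_real a) * (mixed_power (a - 1) b (1 + g x) * (v x * k x)) +
          (cnj c * of_real b) * (mixed_power a (b - 1) (1 + g x) * (cnj (v x) * k x)) \<partial>M)"
      unfolding mixed_power_deriv_def
      by (intro Bochner_Integration.integral_cong refl) (simp add: algebra_simps)
    also have "\<dots> = c * of_real a * I + cnj c * of_real b * J"
      unfolding I_def J_def using int by (subst Bochner_Integration.integral_add) simp_all
    finally show ?thesis .
  qed
  have cv: "(\<lambda>x. c * v x) \<in> Y" for c
    using v by (rule bounded_subspaceD(4)[OF Y])
  have sum: "of_real a * I + of_real b * J = 0"
    using deriv0[OF cv[of 1]] eq[of 1] by simp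
  have "\<i> * (of_real a * I - of_real b * J) = 0"
    using deriv0[OF cv[of \<i>]] eq[of \<i>] by (simp add: right_diff_distrib mult.assoc)
  then have diff: "of_real a * I = of_real b * J"
    by simp
  have "2 * (of_real b * J) = 0"
    using sum unfolding diff mult_2 .
  then have "of_real a * I = 0" "of_real b * J = 0"
    unfolding diff by simp_all
  then show "(\<integral>x. mixed_power (a - 1) b (1 + g x) * (v x * k x) \<partial>M) = 0"
    and "(\<integral>x. mixed_power a (b - 1) (1 + g x) * (cnj (v x) * k x) \<partial>M) = 0"
    using assms(3,4) by (simp_all add: I_def J_def)
qed

text \<open>Induction on the monomial, with the exponents quantified existentially: a factor from
  \<open>Y\<close> lowers \<open>a\<close> by 1 and a conjugated factor lowers \<open>b\<close> by
  1.\<close>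

lemma (in finite_measure) monomials_orthogonal:
  assumes Y: "bounded_subspace M Y" and h: "h \<in> Linf M" and "a \<notin> \<int>" "b \<notin> \<int>"
    and orth: "\<And>g. g \<in> Y \<Longrightarrow> small M g \<Longrightarrow> (\<integral>x. mixed_power a b (1 + g x) * h x \<partial>M) = 0"
    and m: "m \<in> monomials Y"
  shows "(\<integral>x. m x * h x \<partial>M) = 0"
proof -
  have "\<exists>a b. a \<notin> \<int> \<and> b \<notin> \<int> \<and>
    (\<forall>g\<in>Y. small M g \<longrightarrow> (\<integral>x. mixed_power a b (1 + g x) * (m x * h x) \<partial>M) = 0)"
    using m
  proof induction
    case one
    show ?case
      using assms(3,4) orth by auto
  next
    case (mult v m)
    then obtain a b where ab: "a \<notin> \<int>" "b \<notin> \<int>"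
      and orth: "\<And>g. g \<in> Y \<Longrightarrow> small M g \<Longrightarrow> (\<integral>x. mixed_power a b (1 + g x) * (m x * h x) \<partial>M) = 0"
      by blast
    \<comment> \<open>A nonintegral exponent is nonzero, so the differentiation step applies, and it
      stays nonintegral after subtracting 1, so the induction can continue.\<close>
    have nz: "a \<noteq> 0" "b \<noteq> 0" "a - 1 \<notin> \<int>"
      using ab Ints_add[of "a - 1" 1] by auto
    have mh: "(\<lambda>x. m x * h x) \<in> Linf M"
      using Linf_monomial[OF Y mult(2)] h by (rule Linf_mult)
    have "(\<integral>x. mixed_power (a - 1) b (1 + g x) * (v x * m x * h x) \<partial>M) = 0"
      if "g \<in> Y" "small M g" for g
      unfolding mult.assoc[of "v _"]
      by (rule mixed_power_orthogonal_step(1)[OF Y mh _ _ orth that mult(1)]) fact+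
    with nz show ?case
      using ab(2) by blast
  next
    case (mult_cnj v m)
    then obtain a b where ab: "a \<notin> \<int>" "b \<notin> \<int>"
      and orth: "\<And>g. g \<in> Y \<Longrightarrow> small M g \<Longrightarrow> (\<integral>x. mixed_power a b (1 + g x) * (m x * h x) \<partial>M) = 0"
      by blast
    have nz: "a \<noteq> 0" "b \<noteq> 0" "b - 1 \<notin> \<int>"
      using ab Ints_add[of "b - 1" 1] by auto
    have mh: "(\<lambda>x. m x * h x) \<in> Linf M"
      using Linf_monomial[OF Y mult_cnj(2)] h by (rule Linf_mult)
    have "(\<integral>x. mixed_power a (b - 1) (1 + g x) * (cnj (v x) * m x * h x) \<partial>M) = 0"
      if "g \<in> Y" "small M g" for g
      unfolding mult.assoc[of "cnj _"]
      by (rule mixed_power_orthogonal_step(2)[OF Y mh _ _ orth that mult_cnj(1)]) fact+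
    with nz show ?case
      using ab(1) by blast
  qed
  then obtain a b where "\<And>g. g \<in> Y \<Longrightarrow> small M g \<Longrightarrow>
      (\<integral>x. mixed_power a b (1 + g x) * (m x * h x) \<partial>M) = 0"
    by blast
  \<comment> \<open>At \<open>g = 0\<close> the mixed power is 1, whatever exponents the induction
    ended with.\<close>
  moreover have "(\<lambda>x. 0) \<in> Y" "small M (\<lambda>x. 0)"
    using bounded_subspaceD(2)[OF Y] by (auto simp: small_def intro!: exI[of _ 0])
  ultimately show ?thesis
    by fastforce
qed

subsection \<open>From monomials to the generated sigma-algebra\<close>

definition annihilator :: "'a measure \<Rightarrow> ('a \<Rightarrow> complex) set \<Rightarrow> ('a \<Rightarrow> complex) set" where
  "annihilator M S = {k \<in> Linf M. \<forall>m\<in>S. (\<integral>x. m x * k x \<partial>M) = 0}"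

text \<open>Multipliers of an annihilator form an algebra closed under bounded limits. Once an
  indicator is a multiplier, applying it to \<open>h\<close> and testing against the monomial 1
  gives the integral of \<open>h\<close> over the set.\<close>

definition multiplier :: "('a \<Rightarrow> complex) set \<Rightarrow> ('a \<Rightarrow> complex) \<Rightarrow> bool" where
  "multiplier K u \<longleftrightarrow> (\<forall>k\<in>K. (\<lambda>x. u x * k x) \<in> K)"

lemma multiplier_mult:
  assumes "multiplier K u" "multiplier K v"
  shows "multiplier K (\<lambda>x. u x * v x)"
  unfolding multiplier_def
proof
  fix k assume "k \<in> K"
  then have "(\<lambda>x. v x * k x) \<in> K"
    using assms(2) unfolding multiplier_def by blast
  then have "(\<lambda>x. u x * (v x * k x)) \<in> K"
    using assms(1) unfolding multiplier_def by (rule bspec[rotated])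
  then show "(\<lambda>x. u x * v x * k x) \<in> K"
    by (simp add: mult.assoc)
qed

context finite_measure
begin

lemma annihilator_add:
  assumes S: "S \<subseteq> Linf M" and k: "k \<in> annihilator M S" "l \<in> annihilator M S"
  shows "(\<lambda>x. k x + l x) \<in> annihilator M S"
proof -
  have "(\<integral>x. m x * (k x + l x) \<partial>M) = 0" if "m \<in> S" for m
  proof -
    have "(\<integral>x. m x * (k x + l x) \<partial>M) = (\<integral>x. m x * k x \<partial>M) + (\<integral>x. m x * l x \<partial>M)"
      unfolding distrib_left using S k that
      by (intro Bochner_Integration.integral_add Linf_integrable Linf_mult)
        (auto simp: annihilator_def)
    then show ?thesis
      using k that by (simp add: annihilator_def)
  qed
  then show ?thesis
    using k by (auto simp: annihilator_def intro: Linf_add)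
qed

lemma annihilator_cmult:
  assumes "k \<in> annihilator M S"
  shows "(\<lambda>x. c * k x) \<in> annihilator M S"
  using assms by (auto simp: annihilator_def mult.left_commute[of _ c] intro: Linf_mult)

text \<open>The uniform bound \<open>C\<close> does two things: it passes to the limit, which is
  therefore essentially bounded, and it supplies the majorant for dominated convergence.\<close>

lemma annihilator_limit:
  assumes S: "S \<subseteq> Linf M" and k: "\<And>n. k n \<in> annihilator M S"
    and bound: "\<And>n. AE x in M. norm (k n x) \<le> C" and l: "l \<in> borel_measurable M"
    and lim: "AE x in M. (\<lambda>n. k n x) \<longlonglongrightarrow> l x"
  shows "l \<in> annihilator M S"
proof -
  have kL: "k n \<in> Linf M" for n
    using k by (simp add: annihilator_def)
  have "AE x in M. \<forall>n. norm (k n x) \<le> C"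
    using bound by (simp add: AE_all_countable)
  with lim have "AE x in M. norm (l x) \<le> C"
    by eventually_elim (auto intro: Lim_bounded tendsto_norm)
  then have "l \<in> Linf M"
    using l by (intro LinfI)
  moreover have "(\<integral>x. m x * l x \<partial>M) = 0" if m: "m \<in> S" for m
  proof -
    have mL: "m \<in> Linf M"
      using S m by blast
    then obtain B where B: "B \<ge> 0" "AE x in M. norm (m x) \<le> B"
      by (rule LinfE)
    have "(\<lambda>n. \<integral>x. m x * k n x \<partial>M) \<longlonglongrightarrow> (\<integral>x. m x * l x \<partial>M)"
    proof (rule integral_bounded_convergence[where C = "B * C"])
      show "AE x in M. (\<lambda>n. m x * k n x) \<longlonglongrightarrow> m x * l x"
        using lim by eventually_elim (rule tendsto_mult_left)
      show "AE x in M. norm (m x * k n x) \<le> B * C" for n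
        using B(2) bound[of n]
        by eventually_elim (auto simp: norm_mult intro!: mult_mono B(1))
    qed (intro borel_measurable_times l Linf_measurable[OF mL] Linf_measurable[OF kL])+
    moreover have "(\<integral>x. m x * k n x \<partial>M) = 0" for n
      using k m by (auto simp: annihilator_def)
    ultimately show ?thesis
      by (simp add: LIMSEQ_const_iff)
  qed
  ultimately show ?thesis
    by (simp add: annihilator_def)
qed

lemma multiplier_lincomb:
  assumes "S \<subseteq> Linf M" "multiplier (annihilator M S) u" "multiplier (annihilator M S) v"
  shows "multiplier (annihilator M S) (\<lambda>x. c * u x + d * v x)"
  unfolding multiplier_def
proof
  fix k assume "k \<in> annihilator M S"
  then have "(\<lambda>x. c * (u x * k x) + d * (v x * k x)) \<in> annihilator M S"
    using assms unfolding multiplier_def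
    by (intro annihilator_add annihilator_cmult) auto
  then show "(\<lambda>x. (c * u x + d * v x) * k x) \<in> annihilator M S"
    by (simp add: algebra_simps)
qed

lemma multiplier_const: "multiplier (annihilator M S) (\<lambda>x. c)"
  unfolding multiplier_def by (auto intro: annihilator_cmult)

text \<open>Multiplying the sequence by a fixed bounded \<open>k\<close> reduces this to
  \<open>annihilator_limit\<close>. As the limit is taken almost everywhere, a constant sequence
  also allows a multiplier to be changed on a null set.\<close>

lemma multiplier_limit:
  assumes S: "S \<subseteq> Linf M" and u: "\<And>n. multiplier (annihilator M S) (u n)"
    and "\<And>n. AE x in M. norm (u n x) \<le> C" and "v \<in> borel_measurable M"
    and "AE x in M. (\<lambda>n. u n x) \<longlonglongrightarrow> v x"
  shows "multiplier (annihilator M S) v"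
  unfolding multiplier_def
proof
  fix k assume k: "k \<in> annihilator M S"
  then have kL: "k \<in> Linf M"
    by (simp add: annihilator_def)
  then obtain B where B: "AE x in M. norm (k x) \<le> B"
    by (rule LinfE)
  show "(\<lambda>x. v x * k x) \<in> annihilator M S"
  proof (rule annihilator_limit[where k = "\<lambda>n x. u n x * k x" and C = "C * B"])
    show "(\<lambda>x. u n x * k x) \<in> annihilator M S" for n
      using u k by (auto simp: multiplier_def)
    show "AE x in M. norm (u n x * k x) \<le> C * B" for n
      using assms(3)[of n] B
      by eventually_elim (auto simp: norm_mult intro!: mult_mono intro: order_trans[OF norm_ge_zero])
    show "AE x in M. (\<lambda>n. u n x * k x) \<longlonglongrightarrow> v x * k x"
      using assms(5) by eventually_elim (rule tendsto_mult_right)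
  qed (intro S borel_measurable_times assms(4) Linf_measurable[OF kL])+
qed

lemma multiplier_real_polynomial:
  assumes S: "S \<subseteq> Linf M" and u: "multiplier (annihilator M S) (\<lambda>x. complex_of_real (u x))"
    and q: "real_polynomial_function (q :: real \<Rightarrow> real)"
  shows "multiplier (annihilator M S) (\<lambda>x. of_real (q (u x)))"
proof -
  have pow: "multiplier (annihilator M S) (\<lambda>x. of_real (u x) ^ n)" for n
    by (induction n) (auto intro: multiplier_const multiplier_mult u)
  have "multiplier (annihilator M S) (\<lambda>x. \<Sum>i\<le>n. of_real (a i) * of_real (u x) ^ i)" for a n
  proof (induction n)
    case 0
    show ?case using multiplier_const by simp
  next
    case (Suc n)
    show ?case
      using multiplier_lincomb[OF S Suc pow[of "Suc n"], of 1 "of_real (a (Suc n))"] by simp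
  qed
  then show ?thesis
    using q by (auto simp: real_polynomial_function_iff_sum)
qed

text \<open>The indicator of a half-line is a pointwise limit of continuous ramps, and each ramp is
  uniformly close to a polynomial on the essential range of \<open>u\<close>; polynomials in
  \<open>u\<close> are multipliers.\<close>

lemma multiplier_indicator_le:
  assumes S: "S \<subseteq> Linf M" and u: "multiplier (annihilator M S) (\<lambda>x. complex_of_real (u x))"
    and B: "AE x in M. \<bar>u x\<bar> \<le> B"
    and A: "A \<in> sets M" "AE x in M. x \<in> A \<longleftrightarrow> u x \<le> c"
  shows "multiplier (annihilator M S) (indicator A)"
proof -
  \<comment> \<open>For positive \<open>n\<close> the ramp is 1 up to \<open>c\<close> and falls
    linearly to 0 at \<open>c + 1/n\<close>.\<close>
  define \<psi> where "\<psi> n s = max 0 (1 - real n * max 0 (s - c))" for n s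
  \<comment> \<open>The error \<open>1 / real (Suc n)\<close> tends to 0, so polynomials and ramps
    share their limit; it is at most 1, so the polynomials are bounded by 2.\<close>
  have "\<exists>q. real_polynomial_function q \<and> (\<forall>s\<in>{-B..B}. \<bar>\<psi> n s - q s\<bar> < 1 / real (Suc n))" for n
    by (rule Stone_Weierstrass_real_polynomial_function[of "{-B..B}" "\<psi> n" "1 / real (Suc n)"])
      (auto simp: \<psi>_def intro!: continuous_intros)
  then obtain q where q: "\<And>n. real_polynomial_function (q n)"
    "\<And>n s. s \<in> {-B..B} \<Longrightarrow> \<bar>\<psi> n s - q n s\<bar> < 1 / real (Suc n)"
    by metis
  have q_approx: "\<bar>\<psi> n s - q n s\<bar> < 1 / real (Suc n)" if "\<bar>s\<bar> \<le> B" for n s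
    by (rule q(2)) (use that in \<open>simp add: abs_le_iff\<close>)
  have \<psi>_lim: "(\<lambda>n. \<psi> n s) \<longlonglongrightarrow> (if s \<le> c then 1 else 0)" for s
  proof (cases "s \<le> c")
    case True
    then show ?thesis by (simp add: \<psi>_def)
  next
    case False
    obtain N where N: "1 / (s - c) < real N"
      using reals_Archimedean2 by blast
    have "\<psi> n s = 0" if "n \<ge> N" for n
    proof -
      have "1 / (s - c) \<le> real n"
        using N that by linarith
      then show ?thesis
        using False by (simp add: \<psi>_def field_simps)
    qed
    then have "(\<lambda>n. \<psi> n s) \<longlonglongrightarrow> 0"
      by (intro tendsto_eventually eventually_sequentiallyI[of N])
    then show ?thesis
      using False by simp
  qed
  have q_lim: "(\<lambda>n. q n s) \<longlonglongrightarrow> (if s \<le> c then 1 else 0)" if "\<bar>s\<bar> \<le> B" for s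
  proof -
    have "(\<lambda>n. q n s - \<psi> n s) \<longlonglongrightarrow> 0"
    proof (rule Lim_null_comparison)
      show "\<forall>\<^sub>F n in sequentially. norm (q n s - \<psi> n s) \<le> 1 / real (Suc n)"
        using q_approx[OF that]
        by (intro always_eventually allI less_imp_le) (simp add: abs_minus_commute)
      show "(\<lambda>n. 1 / real (Suc n)) \<longlonglongrightarrow> 0"
        using LIMSEQ_inverse_real_of_nat by (simp add: inverse_eq_divide)
    qed
    then show ?thesis
      using tendsto_add[OF _ \<psi>_lim[of s]] by fastforce
  qed
  have q_bound: "\<bar>q n s\<bar> \<le> 2" if "\<bar>s\<bar> \<le> B" for n s
  proof -
    have "\<bar>\<psi> n s\<bar> \<le> 1"
      by (simp add: \<psi>_def)
    moreover have "\<bar>\<psi> n s - q n s\<bar> < 1 / real (Suc n)" "1 / real (Suc n) \<le> 1"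
      using q_approx[OF that] by auto
    ultimately show ?thesis
      by linarith
  qed
  show ?thesis
  proof (rule multiplier_limit[OF S, where C = 2])
    show "multiplier (annihilator M S) (\<lambda>x. of_real (q n (u x)))" for n
      by (rule multiplier_real_polynomial[OF S u q(1)])
    show "AE x in M. norm (complex_of_real (q n (u x))) \<le> 2" for n
      using B by eventually_elim (simp add: q_bound)
    show "AE x in M. (\<lambda>n. complex_of_real (q n (u x))) \<longlonglongrightarrow> indicator A x"
      using B A(2)
    proof eventually_elim
      case (elim x)
      have "complex_of_real (if u x \<le> c then 1 else 0) = indicator A x"
        using elim by (simp add: indicator_def)
      then show ?case
        using tendsto_of_real[OF q_lim[OF elim(1)], where 'a = complex] by simp
    qed
  qed (use A in auto)
qed

text \<open>The sets whose indicators are multipliers form a sigma-algebra, because products of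
  multipliers are multipliers. Vanishing of the integral over a set is by itself not stable under
  intersections, hence the detour through multipliers.\<close>

lemma multiplier_indicator_sigma:
  assumes S: "S \<subseteq> Linf M" and G: "G \<subseteq> sets M"
    and mult: "\<And>A. A \<in> G \<Longrightarrow> multiplier (annihilator M S) (indicator A)"
    and A: "A \<in> sigma_sets (space M) G"
  shows "multiplier (annihilator M S) (indicator A)"
  using A
proof induction
  case (Basic A)
  then show ?case by (rule mult)
next
  case Empty
  show ?case
    using multiplier_const[of S 0] by simp
next
  case (Compl A)
  have A: "A \<in> sets M"
    using sets.sigma_sets_subset[OF G] Compl.hyps by blast
  show ?case
  \<comment> \<open>The function \<open>1 - indicator A\<close> differs from the indicator of the
    complement outside \<open>space M\<close>; a constant sequence in the limit lemma absorbs the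
    difference.\<close>
  proof (rule multiplier_limit[OF S, where C = 1])
    show "multiplier (annihilator M S) (\<lambda>x. 1 - indicator A x)"
      using multiplier_lincomb[OF S multiplier_const[of S 1] Compl.IH, of 1 "- 1"] by simp
    show "AE x in M. (\<lambda>n. 1 - indicator A x :: complex) \<longlonglongrightarrow> indicator (space M - A) x"
      by (rule AE_I2) (auto simp: indicator_def)
  qed (use A in \<open>auto simp: indicator_def\<close>)
next
  case (Union A)
  have A: "A i \<in> sets M" for i
    using sets.sigma_sets_subset[OF G] Union.hyps by blast
  show ?case
  proof (rule multiplier_limit[OF S, where C = 1])
    show "multiplier (annihilator M S) (indicator (\<Union>i<n. A i))" for n
    proof (induction n)
      case 0
      show ?case
        using multiplier_const[of S 0] by simp
    next
      case (Suc n)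
      let ?B = "\<Union>i<n. A i"
      \<comment> \<open>Inclusion-exclusion for two sets that need not be disjoint; the product is
        the indicator of the intersection.\<close>
      have "multiplier (annihilator M S)
          (\<lambda>x. 1 * (1 * indicator ?B x + 1 * indicator (A n) x) + - 1 * (indicator ?B x * indicator (A n) x))"
        by (intro multiplier_lincomb S Suc Union.IH multiplier_mult)
      also have "(\<lambda>x. 1 * (1 * indicator ?B x + 1 * indicator (A n) x) +
          - 1 * (indicator ?B x * indicator (A n) x)) = (indicator (\<Union>i<Suc n. A i) :: 'a \<Rightarrow> complex)"
        by (rule ext) (auto simp: indicator_def less_Suc_eq)
      finally show ?case .
    qed
    show "AE x in M. (\<lambda>n. indicator (\<Union>i<n. A i) x :: complex) \<longlonglongrightarrow> indicator (\<Union>i. A i) x"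
      by (simp add: LIMSEQ_indicator_UN)
  qed (use A in \<open>auto simp: indicator_def\<close>)
qed

end

section \<open>The sigma-algebra of level sets\<close>

text \<open>Membership is only required almost everywhere, so null sets are level sets of \<open>0 \<in> Y\<close>.\<close>

definition level_sets :: "'a measure \<Rightarrow> ('a \<Rightarrow> complex) set \<Rightarrow> 'a set set" where
  "level_sets M Y = {A \<in> sets M. \<exists>u\<in>Y. \<exists>c. AE x in M. x \<in> A \<longleftrightarrow> Re (u x) \<le> c}"

lemma level_sets_Pow: "level_sets M Y \<subseteq> Pow (space M)"
  using sets.sets_into_space by (auto simp: level_sets_def)

lemma complete_subalgebra_level_sets:
  assumes Y: "bounded_subspace M Y"
  shows "complete_subalgebra M (sigma (space M) (level_sets M Y))"
proof -
  have "sigma_sets (space M) (level_sets M Y) \<subseteq> sets M"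
    by (intro sets.sigma_sets_subset) (auto simp: level_sets_def)
  moreover have "N \<in> level_sets M Y" if "N \<in> null_sets M" for N
  proof -
    \<comment> \<open>The threshold -1 makes the level set of the zero function empty, and
      \<open>N\<close> agrees with it almost everywhere.\<close>
    have "AE x in M. x \<in> N \<longleftrightarrow> Re 0 \<le> - 1"
      using AE_not_in[OF that] by eventually_elim simp
    then show ?thesis
      using null_setsD2[OF that] bounded_subspaceD(2)[OF Y] unfolding level_sets_def
      by (intro CollectI conjI bexI[of _ "\<lambda>x. 0"] exI[of _ "- 1"]) simp_all
  qed
  ultimately show ?thesis
    unfolding complete_subalgebra_def subalgebra_def
    by (auto simp: level_sets_Pow)
qed

lemma measurable_level_sets:
  assumes Y: "bounded_subspace M Y" and g: "g \<in> Y"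
  shows "g \<in> borel_measurable (sigma (space M) (level_sets M Y))"
proof -
  have Re: "(\<lambda>x. Re (u x)) \<in> borel_measurable (sigma (space M) (level_sets M Y))" if u: "u \<in> Y" for u
  proof (rule borel_measurableI_le)
    fix c
    note [measurable] = Linf_measurable[OF bounded_subspaceD(1)[OF Y u]]
    have "{x \<in> space M. Re (u x) \<le> c} \<in> level_sets M Y"
      unfolding level_sets_def using u by (auto intro!: bexI[of _ u] exI[of _ c] AE_I2)
    then show "{x \<in> space (sigma (space M) (level_sets M Y)). Re (u x) \<le> c}
        \<in> sets (sigma (space M) (level_sets M Y))"
      by (simp add: level_sets_Pow)
  qed
  \<comment> \<open>Level sets of real parts suffice: \<open>Im (g x)\<close> is the real part of
    \<open>- \<i> * g x\<close>, and \<open>Y\<close> is a complex subspace.\<close>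
  have "(\<lambda>x. Im (g x)) \<in> borel_measurable (sigma (space M) (level_sets M Y))"
    using Re[OF bounded_subspaceD(4)[OF Y g, of "- \<i>"]] by simp
  with Re[OF g] show ?thesis
    by (simp add: borel_measurable_complex_iff)
qed

text \<open>Multipliers are enlarged in stages: elements of \<open>Y\<close> and their conjugates,
  real parts, indicators of level sets, indicators of the generated sigma-algebra. The last are
  applied to \<open>h\<close>.\<close>

lemma (in finite_measure) integral_level_sets_eq_0:
  assumes Y: "bounded_subspace M Y" and h: "h \<in> Linf M"
    and orth: "\<And>m. m \<in> monomials Y \<Longrightarrow> (\<integral>x. m x * h x \<partial>M) = 0"
    and A: "A \<in> sets (sigma (space M) (level_sets M Y))"
  shows "(\<integral>x. indicator A x * h x \<partial>M) = 0"
proof -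
  let ?K = "annihilator M (monomials Y)"
  have S: "monomials Y \<subseteq> Linf M"
    using Linf_monomial[OF Y] by blast
  have mult: "multiplier ?K u" "multiplier ?K (\<lambda>x. cnj (u x))" if u: "u \<in> Y" for u
  proof -
    have uL: "u \<in> Linf M"
      using u by (rule bounded_subspaceD(1)[OF Y])
    \<comment> \<open>The factor \<open>u\<close> or its conjugate is moved from \<open>k\<close> to
      the test monomial, which remains a monomial.\<close>
    have "(\<integral>x. m x * (u x * k x) \<partial>M) = 0" "(\<integral>x. m x * (cnj (u x) * k x) \<partial>M) = 0"
      if "k \<in> ?K" "m \<in> monomials Y" for k m
      using that monomials.mult[OF u that(2)] monomials.mult_cnj[OF u that(2)]
      by (auto simp: annihilator_def mult.assoc mult.left_commute)
    then show "multiplier ?K u" "multiplier ?K (\<lambda>x. cnj (u x))"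
      using uL Linf_cnj[OF uL] by (auto simp: multiplier_def annihilator_def intro!: Linf_mult)
  qed
  have "multiplier ?K (indicator A)"
  proof (rule multiplier_indicator_sigma[OF S, where G = "level_sets M Y"])
    show "level_sets M Y \<subseteq> sets M"
      by (auto simp: level_sets_def)
    show "A \<in> sigma_sets (space M) (level_sets M Y)"
      using A by (simp add: level_sets_Pow)
    fix B assume "B \<in> level_sets M Y"
    then obtain u c where B: "B \<in> sets M" and u: "u \<in> Y" and uc: "AE x in M. x \<in> B \<longleftrightarrow> Re (u x) \<le> c"
      by (auto simp: level_sets_def)
    obtain C where C: "AE x in M. norm (u x) \<le> C"
      using bounded_subspaceD(1)[OF Y u] by (rule LinfE)
    have "multiplier ?K (\<lambda>x. (1/2) * u x + (1/2) * cnj (u x))"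
      by (intro multiplier_lincomb S mult u)
    also have "(\<lambda>x. (1/2) * u x + (1/2) * cnj (u x)) = (\<lambda>x. of_real (Re (u x)))"
      by (simp add: fun_eq_iff complex_eq_iff)
    finally have "multiplier ?K (\<lambda>x. of_real (Re (u x)))" .
    moreover have "AE x in M. \<bar>Re (u x)\<bar> \<le> C"
      using C by eventually_elim (rule order_trans[OF abs_Re_le_cmod])
    ultimately show "multiplier ?K (indicator B)"
      using B uc by (intro multiplier_indicator_le[OF S, where u = "\<lambda>x. Re (u x)"])
  qed
  moreover have "h \<in> ?K"
    using h orth by (simp add: annihilator_def)
  ultimately have "(\<lambda>x. indicator A x * h x) \<in> ?K"
    by (simp add: multiplier_def)
  then show ?thesis
    using monomials.one[of Y] by (fastforce simp: annihilator_def)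
qed

subsection \<open>The projection\<close>

text \<open>Both integrals have the same value at \<open>t = 0\<close>, so the inequality passes to
  their right derivatives there. Each derivative is \<open>p\<close> times the real part of the
  corresponding integral in the conclusion.\<close>

lemma (in finite_measure) norm_powr_first_order:
  assumes p: "p > 0" and small: "small M g" and g: "g \<in> borel_measurable M"
    and f: "f \<in> Linf M" and q: "q \<in> Linf M"
    and le: "\<And>t. t > 0 \<Longrightarrow> (\<integral>x. norm (1 + (g x + of_real t * q x)) powr p \<partial>M)
                        \<le> (\<integral>x. norm (1 + (g x + of_real t * f x)) powr p \<partial>M)"
  shows "Re (\<integral>x. mixed_power (p/2 - 1) (p/2) (1 + g x) * q x \<partial>M)
       \<le> Re (\<integral>x. mixed_power (p/2 - 1) (p/2) (1 + g x) * f x \<partial>M)"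
proof -
  let ?A = "\<lambda>x. mixed_power (p/2 - 1) (p/2) (1 + g x)"
  obtain t where t: "\<And>n. t n > 0" "t \<longlonglongrightarrow> 0"
    and small_t: "\<And>n. small M (\<lambda>x. g x + of_real (t n) * f x)" "\<And>n. small M (\<lambda>x. g x + of_real (t n) * q x)"
    using small_perturbation_steps[OF small f q] by metis
  have deriv: "(\<integral>x. mixed_power_deriv (p/2) (p/2) (1 + g x) (u x) * 1 \<partial>M) =
      of_real (p * Re (\<integral>x. ?A x * u x \<partial>M))" if u: "u \<in> Linf M" for u
  proof -
    have int: "integrable M (\<lambda>x. ?A x * u x)"
      using u small g by (intro Linf_integrable Linf_mult Linf_mixed_power)
    have "mixed_power_deriv (p/2) (p/2) (1 + g x) (u x) * 1 = of_real (p * Re (?A x * u x))" for x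
    proof -
      \<comment> \<open>With equal exponents the two summands of the derivative are conjugate to
        each other, so their sum is twice a real part.\<close>
      have "mixed_power_deriv (p/2) (p/2) (1 + g x) (u x) * 1 =
          of_real (p/2) * (?A x * u x + cnj (?A x * u x))"
        by (simp add: mixed_power_deriv_def cnj_mixed_power algebra_simps)
      also have "\<dots> = of_real (p * Re (?A x * u x))"
        by (simp add: complex_add_cnj del: complex_cnj_mult)
      finally show ?thesis .
    qed
    then have "(\<integral>x. mixed_power_deriv (p/2) (p/2) (1 + g x) (u x) * 1 \<partial>M) =
        (\<integral>x. complex_of_real (p * Re (?A x * u x)) \<partial>M)"
      by (simp only:)
    also have "\<dots> = of_real (\<integral>x. p * Re (?A x * u x) \<partial>M)"
      by (rule integral_complex_of_real)
    also have "(\<integral>x. p * Re (?A x * u x) \<partial>M) = p * Re (\<integral>x. ?A x * u x \<partial>M)"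
      by (simp only: integral_mult_right_zero integral_Re[OF int])
    finally show ?thesis .
  qed
  define L where "L u = p * Re (\<integral>x. ?A x * u x \<partial>M)" for u
  define I where "I u = (\<integral>x. norm (1 + u x) powr p \<partial>M)" for u :: "'a \<Rightarrow> complex"
  have I: "(\<integral>x. mixed_power (p/2) (p/2) (1 + u x) * 1 \<partial>M) = complex_of_real (I u)" for u
    by (simp add: mixed_power_diagonal I_def)
  have quotient: "(\<lambda>n. (I (\<lambda>x. g x + of_real (t n) * u x) - I g) / t n) \<longlonglongrightarrow> L u"
    if "u \<in> Linf M" "\<And>n. small M (\<lambda>x. g x + of_real (t n) * u x)" for u
  proof -
    have "(\<lambda>n. complex_of_real ((I (\<lambda>x. g x + of_real (t n) * u x) - I g) / t n)) \<longlonglongrightarrow> of_real (L u)"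
      using integral_mixed_power_difference_quotient[OF small g that(1) Linf_const t that(2), of "p/2" "p/2" 1]
      unfolding deriv[OF that(1)] I L_def by simp
    then show ?thesis
      by (simp only: tendsto_of_real_iff)
  qed
  have "L q \<le> L f"
  proof (rule LIMSEQ_le[OF quotient quotient])
    show "\<exists>N. \<forall>n\<ge>N. (I (\<lambda>x. g x + of_real (t n) * q x) - I g) / t n \<le> (I (\<lambda>x. g x + of_real (t n) * f x) - I g) / t n"
      using le[OF t(1)] t(1) by (auto simp: I_def intro!: divide_right_mono less_imp_le[OF t(1)])
  qed (use f q small_t in auto)
  then show ?thesis
    using p by (simp add: L_def)
qed

section \<open>Contractivity as an inequality between integrals\<close>

lemma closed_subspace_LpD:
  assumes "closed_subspace_Lp p M X"
  shows "f \<in> X \<Longrightarrow> f \<in> Lp p M"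
    "f \<in> X \<Longrightarrow> g \<in> X \<Longrightarrow> (\<lambda>x. f x + g x) \<in> X" "f \<in> X \<Longrightarrow> (\<lambda>x. c * f x) \<in> X"
  using assms unfolding closed_subspace_Lp_def by blast+

lemma Lp_norm_cmult:
  assumes "p > 0"
  shows "Lp_norm p M (\<lambda>x. c * f x) = norm c * Lp_norm p M f"
  using assms by (simp add: Lp_norm_def norm_mult powr_mult powr_powr)

lemma Lp_norm_cong:
  assumes "ae_eq M f g" "f \<in> borel_measurable M" "g \<in> borel_measurable M"
  shows "Lp_norm p M f = Lp_norm p M g"
proof -
  have "(\<integral>x. norm (f x) powr p \<partial>M) = (\<integral>x. norm (g x) powr p \<partial>M)"
    using assms by (intro integral_cong_AE) (auto simp: ae_eq_def elim!: eventually_mono)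
  then show ?thesis
    by (simp add: Lp_norm_def)
qed

text \<open>By homogeneity a function of nonzero quasi-norm is scaled to the unit sphere, where the
  supremum applies. Quasi-norm zero is covered by the bound \<open>C\<close> of the
  operator.\<close>

lemma contractive_projection_Lp_norm_le:
  assumes p: "p > 0" and X: "closed_subspace_Lp p M X" and P: "contractive_projection p M X P" and f: "f \<in> X"
  shows "Lp_norm p M (P f) \<le> Lp_norm p M f"
proof -
  have XL: "u \<in> borel_measurable M" if "u \<in> X" for u
    using closed_subspace_LpD(1)[OF X that] by (simp add: Lp_def)
  have P_op: "bounded_linear_operator_on p M X P" "operator_norm p M X P = 1"
    using P unfolding contractive_projection_def by blast+
  then obtain C where C: "\<And>u. u \<in> X \<Longrightarrow> Lp_norm p M (P u) \<le> C * Lp_norm p M u"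
    and PX: "\<And>u. u \<in> X \<Longrightarrow> P u \<in> X"
    and Pc: "\<And>u c. u \<in> X \<Longrightarrow> ae_eq M (P (\<lambda>x. c * u x)) (\<lambda>x. c * P u x)"
    unfolding bounded_linear_operator_on_def by blast
  have cX: "(\<lambda>x. c * u x) \<in> X" if "u \<in> X" for u c
    using X that by (rule closed_subspace_LpD)
  show ?thesis
  proof (cases "Lp_norm p M f = 0")
    case True
    then show ?thesis using C[OF f] by simp
  next
    case False
    define r where "r = Lp_norm p M f"
    have r: "r > 0"
      using False by (simp add: r_def Lp_norm_def less_le)
    define u where "u = (\<lambda>x. complex_of_real (1 / r) * f x)"
    have u: "u \<in> X" "Lp_norm p M u = 1"
      unfolding u_def Lp_norm_cmult[OF p]
      using r by (simp_all add: cX[OF f] r_def[symmetric] norm_divide del: of_real_divide)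
    \<comment> \<open>A real supremum dominates its set only if the set is bounded above;
      \<open>C\<close> is such a bound.\<close>
    have "bdd_above ((\<lambda>f. Lp_norm p M (P f)) ` {f \<in> X. Lp_norm p M f = 1})"
      using C by (intro bdd_aboveI[of _ C]) force
    then have "Lp_norm p M (P u) \<le> 1"
      using u P_op(2) unfolding operator_norm_def by (metis (mono_tags, lifting) cSUP_upper mem_Collect_eq)
    moreover have "Lp_norm p M (P u) = Lp_norm p M (\<lambda>x. of_real (1 / r) * P f x)"
      using Pc[OF f, of "of_real (1 / r)"] XL PX cX f u
      unfolding u_def by (intro Lp_norm_cong) auto
    ultimately show ?thesis
      using r unfolding Lp_norm_cmult[OF p] by (simp add: norm_divide r_def[symmetric] divide_le_eq)
  qed
qed

lemma integral_norm_powr_le_of_Lp_norm_le: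
  assumes p: "p > 0" and le: "Lp_norm p M f \<le> Lp_norm p M g"
  shows "(\<integral>x. norm (f x) powr p \<partial>M) \<le> (\<integral>x. norm (g x) powr p \<partial>M)"
proof -
  have "Lp_norm p M f powr p \<le> Lp_norm p M g powr p"
    using p le by (intro powr_mono2) (auto simp: Lp_norm_def)
  then show ?thesis
    using p by (simp add: Lp_norm_def powr_powr)
qed

theorem theorem1p1:
  fixes p :: real and M :: "'a measure"
    and X :: "('a \<Rightarrow> complex) set"
    and P :: "('a \<Rightarrow> complex) \<Rightarrow> 'a \<Rightarrow> complex"
    and \<E> :: "('a \<Rightarrow> complex) set"
  assumes "0 < p" and "p < 1"
    and "prob_space M" and "complete_measure M"
    and "closed_subspace_Lp p M X"
    and "\<And>c :: complex. (\<lambda>x. c) \<in> X"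
    and "contractive_projection p M X P"
    and "ae_eq M (P (\<lambda>x. 1)) (\<lambda>x. 1)"
  defines "\<E> \<equiv> {f \<in> X. f \<in> Linf M \<and> P f \<in> Linf M}"
  shows "\<exists>F. complete_subalgebra M F \<and>
    (\<forall>f\<in>\<E>. ae_eq M (P f) (complex_cond_exp M F f))"
proof -
  interpret prob_space M by fact
  note p = \<open>0 < p\<close> and XD = closed_subspace_LpD[OF assms(5)]
  have const: "(\<lambda>x. c) \<in> X" for c :: complex by fact
  have XM: "u \<in> borel_measurable M" if "u \<in> X" for u
    using XD(1)[OF that] by (simp add: Lp_def)
  have P_op: "bounded_linear_operator_on p M X P"
    and P_idem: "\<And>u. u \<in> X \<Longrightarrow> AE x in M. P (P u) x = P u x"
    using assms(7) unfolding contractive_projection_def ae_eq_def by blast+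
  then have PX: "\<And>u. u \<in> X \<Longrightarrow> P u \<in> X"
    and P_add: "\<And>u v. u \<in> X \<Longrightarrow> v \<in> X \<Longrightarrow> AE x in M. P (\<lambda>x. u x + v x) x = P u x + P v x"
    and P_cmult: "\<And>u c. u \<in> X \<Longrightarrow> AE x in M. P (\<lambda>x. c * u x) x = c * P u x"
    unfolding bounded_linear_operator_on_def ae_eq_def by blast+
  have P_one: "AE x in M. P (\<lambda>x. 1) x = 1"
    using assms(8) by (simp add: ae_eq_def)
  define Y where "Y = {g \<in> X. g \<in> Linf M \<and> (AE x in M. P g x = g x)}"
  have YI: "g \<in> Y" if "g \<in> X" "g \<in> Linf M" "AE x in M. P g x = g x" for g
    using that by (simp add: Y_def)
  have YD: "g \<in> X" "g \<in> Linf M" "AE x in M. P g x = g x" if "g \<in> Y" for g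
    using that by (simp_all add: Y_def)
  have Y_cmult: "(\<lambda>x. c * g x) \<in> Y" if "g \<in> X" "g \<in> Linf M" "AE x in M. P g x = g x" for c g
  proof (rule YI)
    show "AE x in M. P (\<lambda>x. c * g x) x = c * g x"
      using P_cmult[OF that(1)] that(3) by eventually_elim simp
  qed (use that in \<open>auto intro: Linf_mult XD(3)\<close>)
  have Y_add: "(\<lambda>x. g x + h x) \<in> Y" if "g \<in> Y" "h \<in> Y" for g h
  proof (rule YI)
    show "AE x in M. P (\<lambda>x. g x + h x) x = g x + h x"
      using P_add[OF YD(1)[OF that(1)] YD(1)[OF that(2)]] YD(3)[OF that(1)] YD(3)[OF that(2)]
      by eventually_elim simp
  qed (use YD that in \<open>auto intro: Linf_add XD(2)\<close>)
  have Y: "bounded_subspace M Y"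
    unfolding bounded_subspace_def
    \<comment> \<open>The zero function is obtained as 0 times the constant 1, which
      \<open>P\<close> fixes.\<close>
    using YD Y_cmult[OF _ _ P_one, of 0] const Y_add by (auto intro: Y_cmult)
  define F where "F = sigma (space M) (level_sets M Y)"
  have F: "complete_subalgebra M F"
    unfolding F_def by (rule complete_subalgebra_level_sets[OF Y])
  interpret F: finite_measure_subalgebra M F
    using F by unfold_locales (simp add: complete_subalgebra_def)
  have "ae_eq M (P f) (complex_cond_exp M F f)" if "f \<in> \<E>" for f
  proof -
    have f: "f \<in> X" "f \<in> Linf M" "P f \<in> Linf M"
      using that by (simp_all add: \<E>_def)
    have PfY: "P f \<in> Y"
      by (rule YI[OF PX[OF f(1)] f(3) P_idem[OF f(1)]])
    have orth: "(\<integral>x. mixed_power (p/2 - 1) (p/2) (1 + g x) * (f x - P f x) \<partial>M) = 0"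
      if g: "g \<in> Y" "small M g" for g
    proof -
      let ?A = "\<lambda>x. mixed_power (p/2 - 1) (p/2) (1 + g x)"
      define z where "z = (\<integral>x. ?A x * (f x - P f x) \<partial>M)"
      \<comment> \<open>The complex scalar \<open>c\<close> rotates the direction of perturbation;
        varying it will turn the inequality of real parts into an equation.\<close>
      have le: "Re (\<integral>x. ?A x * (c * P f x) \<partial>M) \<le> Re (\<integral>x. ?A x * (c * f x) \<partial>M)" for c
      proof (rule norm_powr_first_order[OF p g(2) Linf_measurable[OF YD(2)[OF g(1)]]])
        fix t :: real
        define w where "w = (\<lambda>x. 1 + (g x + (of_real t * c) * f x))"
        have cf: "(\<lambda>x. (of_real t * c) * f x) \<in> X"
          by (rule XD(3)[OF f(1)])
        have gcf: "(\<lambda>x. g x + (of_real t * c) * f x) \<in> X"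
          by (rule XD(2)[OF YD(1)[OF g(1)] cf])
        have w: "w \<in> X"
          unfolding w_def by (rule XD(2)[OF const gcf])
        \<comment> \<open>The constant 1 and \<open>g\<close> are fixed by \<open>P\<close>, so only
          the perturbation changes, from \<open>f\<close> to \<open>P f\<close>.\<close>
        have "AE x in M. P w x = 1 + (g x + of_real t * (c * P f x))"
          unfolding w_def
          using P_add[OF const[of 1] gcf] P_add[OF YD(1)[OF g(1)] cf] P_cmult[OF f(1), of "of_real t * c"]
            P_one YD(3)[OF g(1)]
          by eventually_elim simp
        then have "Lp_norm p M (\<lambda>x. 1 + (g x + of_real t * (c * P f x))) = Lp_norm p M (P w)"
          using XM[OF YD(1)[OF g(1)]] XM[OF PX[OF f(1)]] XM[OF PX[OF w]]
          by (intro Lp_norm_cong) (auto simp: ae_eq_def elim!: eventually_mono)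
        also have "\<dots> \<le> Lp_norm p M w"
          by (rule contractive_projection_Lp_norm_le[OF p assms(5,7) w])
        also have "w = (\<lambda>x. 1 + (g x + of_real t * (c * f x)))"
          by (simp add: w_def mult.assoc)
        finally show "(\<integral>x. norm (1 + (g x + of_real t * (c * P f x))) powr p \<partial>M)
            \<le> (\<integral>x. norm (1 + (g x + of_real t * (c * f x))) powr p \<partial>M)"
          by (rule integral_norm_powr_le_of_Lp_norm_le[OF p])
      qed (use f in \<open>auto intro: Linf_mult\<close>)
      have int: "integrable M (\<lambda>x. ?A x * u x)" if "u \<in> Linf M" for u
        using that g by (intro Linf_integrable Linf_mult Linf_mixed_power Linf_measurable[OF YD(2)])
      have "Re (c * z) \<ge> 0" for c
      proof -
        have "z = (\<integral>x. ?A x * f x \<partial>M) - (\<integral>x. ?A x * P f x \<partial>M)"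
          unfolding z_def right_diff_distrib
          by (intro Bochner_Integration.integral_diff int f)
        moreover have "(\<integral>x. ?A x * (c * u x) \<partial>M) = c * (\<integral>x. ?A x * u x \<partial>M)" for u
          unfolding mult.left_commute[of "mixed_power _ _ _"] by (rule integral_mult_right_zero)
        ultimately have "Re (c * z) = Re (\<integral>x. ?A x * (c * f x) \<partial>M) - Re (\<integral>x. ?A x * (c * P f x) \<partial>M)"
          by (simp only: right_diff_distrib minus_complex.sel)
        then show ?thesis
          using le[of c] by simp
      qed
      \<comment> \<open>For this \<open>c\<close> the nonnegative real part is minus the squared
        modulus of \<open>z\<close>, which forces \<open>z = 0\<close>.\<close>
      from this[of "- cnj z"] have "(norm z)\<^sup>2 \<le> 0"
        unfolding cmod_power2 by (simp add: power2_eq_square)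
      then show ?thesis
        by (simp add: z_def)
    qed
    \<comment> \<open>Here \<open>p/2\<close> lies strictly between 0 and 1/2; this supplies the
      nonintegral exponents from which the differentiation starts.\<close>
    have half: "p/2 \<notin> \<int>"
      using assms(1,2) by (auto elim!: Ints_cases)
    then have half': "p/2 - 1 \<notin> \<int>"
      using Ints_add[of "p/2 - 1" 1] by auto
    have fPf: "(\<lambda>x. f x - P f x) \<in> Linf M"
      by (rule Linf_diff[OF f(2,3)])
    have int: "integrable M f" "integrable M (P f)"
      using f by (auto intro: Linf_integrable)
    have "AE x in M. complex_cond_exp M F f x = P f x"
    \<comment> \<open>As \<open>P f\<close> lies in \<open>Y\<close>, it is measurable for
      \<open>F\<close>; what remains is that \<open>f - P f\<close> has integral zero over each set
      of \<open>F\<close>.\<close>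
    proof (rule F.complex_cond_exp_unique[OF int])
      show "P f \<in> borel_measurable F"
        unfolding F_def by (rule measurable_level_sets[OF Y PfY])
      fix A assume A: "A \<in> sets F"
      have AM: "A \<in> sets M"
        using A F.subalg by (auto simp: subalgebra_def)
      have "0 = (\<integral>x. indicator A x * (f x - P f x) \<partial>M)"
        using integral_level_sets_eq_0[OF Y fPf monomials_orthogonal[OF Y fPf half' half orth]] A
        by (simp add: F_def)
      also have "\<dots> = (\<integral>x. indicator A x * f x \<partial>M) - (\<integral>x. indicator A x * P f x \<partial>M)"
        unfolding right_diff_distrib
        using f Linf_indicator[OF AM]
        by (intro Bochner_Integration.integral_diff Linf_integrable Linf_mult)
      finally show "(\<integral>x\<in>A. P f x \<partial>M) = (\<integral>x\<in>A. f x \<partial>M)"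
        by (simp add: set_lebesgue_integral_def scaleR_conv_of_real of_real_indicator)
    qed
    then show ?thesis
      unfolding ae_eq_def by eventually_elim simp
  qed
  with F show ?thesis
    by blast
qed

end
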